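(* Let $a=b\in\mathbb{R}\setminus\{0\}$ and let $$G(t,s)=[1+a(s-t)]\,\chi_0^t(s)+a(s+t)\,\chi_{-t}^0(s),\qquad t,s\in\mathbb{R},$$ be the Green's function of the problem $x'(t)+a\,x(-t)+a\,x(t)=h(t)$, $x(t_0)=c$. Then: (i) if $a>0$, $G$ is positive on $[0,1/a]\times\mathbb{R}$, i.e. for every $t\in[0,1/a]$, $G(t,s)\ge0$ for a.e. $s\in\mathbb{R}$; (ii) if $a<0$, $G$ is negative on $[1/a,0]\times\mathbb{R}$, i.e. for every $t\in[1/a,0]$, $G(t,s)\le0$ for a.e. $s\in\mathbb{R}$; (iii) $G$ changes sign (takes both strictly positive and strictly negative values) on every strip which is not a subset of the previous ones: on $J\times\mathbb{R}$ for every interval $J\subset\mathbb{R}$ with $J\not\subset[0,1/a]$ if $a>0$, and for every interval $J\subset\mathbb{R}$ with $J\not\subset[1/a,0]$ if $a<0$.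
   Context: For $t_1,t_2\in\mathbb{R}$, $\chi_{t_1}^{t_2}(s)=1$ if $t_1\le s\le t_2$, $\chi_{t_1}^{t_2}(s)=-1$ if $t_2\le s<t_1$, and $\chi_{t_1}^{t_2}(s)=0$ otherwise. *)

theory Defs
  imports "HOL-Analysis.Analysis"
begin

text \<open>The oriented characteristic function: for integrable \<open>f\<close>, integrating
  \<open>chi t1 t2 s * f s\<close> over all \<open>s\<close> gives the signed integral of \<open>f\<close> from \<open>t1\<close> to \<open>t2\<close>.\<close>

definition chi :: "real \<Rightarrow> real \<Rightarrow> real \<Rightarrow> real" where
  "chi t1 t2 s =
     (if t1 \<le> s \<and> s \<le> t2 then 1
      else if t2 \<le> s \<and> s < t1 then - 1
      else 0)"

text \<open>The Green's function of \<open>x'(t) + a x(-t) + a x(t) = h(t)\<close>, \<open>x(t0) = c\<close>,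
  given by its explicit formula. It depends neither on \<open>t0\<close> nor on \<open>c\<close>.\<close>

definition green :: "real \<Rightarrow> real \<Rightarrow> real \<Rightarrow> real" where
  "green a t s = (1 + a * (s - t)) * chi 0 t s + a * (s + t) * chi (- t) 0 s"

end

theory Submission
  imports Defs
begin

text \<open>For \<open>t > 0\<close> the kernel is \<open>1 + a (s - t)\<close> on \<open>(0, t]\<close> and \<open>a (s + t)\<close> on \<open>[-t, 0)\<close>; for \<open>t < 0\<close>
  it is \<open>- (1 + a (s - t))\<close> on \<open>[t, 0)\<close> and \<open>- a (s + t)\<close> on \<open>[0, -t)\<close>. On these intervals
  \<open>1 + a (s - t)\<close> is \<open>1\<close> at \<open>s = t\<close> and tends to \<open>1 - a t\<close> as \<open>s\<close> tends to \<open>0\<close>, so it changes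
  sign exactly when \<open>a t > 1\<close>, while \<open>s + t\<close> has the sign of \<open>t\<close>.\<close>

text \<open>At \<open>s = 0\<close> both factors \<open>chi\<close> equal 1 and the terms
  \<open>- a * t\<close> and \<open>a * t\<close> cancel, hence the separate value 1.\<close>

lemma green_pos:
  assumes "t > 0"
  shows "green a t s = (if 0 < s \<and> s \<le> t then 1 + a * (s - t)
                        else if s = 0 then 1
                        else if - t \<le> s \<and> s < 0 then a * (s + t) else 0)"
  using assms by (auto simp: green_def chi_def algebra_simps)

lemma green_neg:
  assumes "t < 0"
  shows "green a t s = (if t \<le> s \<and> s < 0 then - (1 + a * (s - t))
                        else if 0 \<le> s \<and> s < - t then - (a * (s + t)) else 0)"
  using assms by (auto simp: green_def chi_def algebra_simps)

lemma green_zero: "green a 0 s = (if s = 0 then 1 else 0)"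
  by (auto simp: green_def chi_def)

lemma green_nonneg:
  assumes "a > 0" and "0 \<le> t" and "t \<le> 1/a"
  shows "green a t s \<ge> 0"
proof (cases "t = 0")
  case False
  have "a * t \<le> 1"
    using assms by (simp add: field_simps)
  then have "1 + a * (s - t) \<ge> 0" if "s > 0"
    using mult_pos_pos[OF assms(1) that] by (simp add: right_diff_distrib)
  moreover have "a * (s + t) \<ge> 0" if "- t \<le> s"
    using that assms by simp
  ultimately show ?thesis
    using False assms by (auto simp: green_pos)
qed (simp add: green_zero)

text \<open>The last hypothesis excludes just the point \<open>t = s = 0\<close>, where the kernel
  is positive.\<close>

lemma green_nonpos:
  assumes "a < 0" and "1/a \<le> t" and "t \<le> 0" and "t < 0 \<or> s \<noteq> 0"
  shows "green a t s \<le> 0"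
proof (cases "t = 0")
  case False
  have "a * t \<le> 1"
    using assms by (simp add: field_simps)
  moreover have "a * s \<ge> 0" if "s < 0"
    using that assms by (simp add: mult_nonpos_nonpos)
  moreover have "a * (s + t) \<ge> 0" if "s < - t"
    using that assms by (simp add: mult_nonpos_nonpos)
  ultimately show ?thesis
    using False assms by (auto simp: green_neg right_diff_distrib)
qed (use assms in \<open>simp add: green_zero\<close>)

text \<open>Both signs occur at one and the same \<open>t\<close>, so a single point of
  \<open>J\<close> outside the good interval suffices.\<close>

lemma green_changes_sign_pos:
  assumes "a > 0" and "t \<notin> {0..1/a}"
  shows "(\<exists>s. green a t s > 0) \<and> (\<exists>s. green a t s < 0)"
proof (cases "t < 0")
  case True
  \<comment> \<open>The values are \<open>- a * t\<close> and \<open>- 1\<close>.\<close>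
  then have "green a t 0 > 0" "green a t t < 0"
    using assms by (auto simp: green_neg mult_pos_neg)
  then show ?thesis by blast
next
  case False
  \<comment> \<open>As a function of \<open>s\<close>, \<open>1 + a * (s - t)\<close> vanishes at
    \<open>t - r\<close>. The witness \<open>(t - r) / 2\<close> is the midpoint of 0 and this zero;
    the kernel there is \<open>(1 - a * t) / 2\<close>.\<close>
  define r where "r = 1/a"
  have ar: "a * r = 1" and "r > 0"
    using assms by (auto simp: r_def)
  with False have t: "t > r" "t > 0"
    using assms(2) unfolding atLeastAtMost_iff r_def[symmetric] by linarith+
  then have "a * t > 1"
    using assms by (simp add: r_def field_simps)
  moreover have "(t - r) / 2 > 0" "(t - r) / 2 \<le> t"
    using t \<open>r > 0\<close> by simp_all
  moreover have "a * ((t - r) / 2 - t) = - (a * t + 1) / 2"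
    using ar by (simp add: field_simps)
  ultimately have "green a t ((t - r) / 2) < 0"
    using t by (simp add: green_pos)
  moreover have "green a t t > 0"
    using t by (simp add: green_pos)
  ultimately show ?thesis by blast
qed

lemma green_changes_sign_neg:
  assumes "a < 0" and "t \<notin> {1/a..0}"
  shows "(\<exists>s. green a t s > 0) \<and> (\<exists>s. green a t s < 0)"
proof (cases "t > 0")
  case True
  \<comment> \<open>The values are \<open>1\<close> and \<open>a * t / 2\<close>.\<close>
  then have "green a t t > 0" "green a t (- t / 2) < 0"
    using assms by (auto simp: green_pos mult_neg_pos)
  then show ?thesis by blast
next
  case False
  \<comment> \<open>The same midpoint now lies in \<open>[t, 0)\<close>, and the reversed
    orientation gives the kernel the value \<open>(a * t - 1) / 2\<close>.\<close>
  define r where "r = 1/a"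
  have ar: "a * r = 1" and "r < 0"
    using assms by (auto simp: r_def)
  with False have t: "t < r" "t < 0"
    using assms(2) unfolding atLeastAtMost_iff r_def[symmetric] by linarith+
  then have "a * t > 1"
    using assms by (simp add: r_def field_simps)
  moreover have "(t - r) / 2 < 0" "t \<le> (t - r) / 2"
    using t \<open>r < 0\<close> by simp_all
  moreover have "a * ((t - r) / 2 - t) = - (a * t + 1) / 2"
    using ar by (simp add: field_simps)
  ultimately have "green a t ((t - r) / 2) > 0"
    using t by (simp add: green_neg)
  moreover have "green a t t < 0"
    using t by (simp add: green_neg)
  ultimately show ?thesis by blast
qed

theorem mainTheorem8:
  fixes a b :: real
  assumes "a = b" and "a \<noteq> 0"
  shows "(a > 0 \<longrightarrow> (\<forall>t\<in>{0..1/a}. AE s in lebesgue. green a t s \<ge> 0))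
    \<and> (a < 0 \<longrightarrow> (\<forall>t\<in>{1/a..0}. AE s in lebesgue. green a t s \<le> 0))
    \<and> (a > 0 \<longrightarrow> (\<forall>J :: real set. is_interval J \<and> \<not> J \<subseteq> {0..1/a} \<longrightarrow>
          (\<exists>t\<in>J. \<exists>s. green a t s > 0) \<and> (\<exists>t\<in>J. \<exists>s. green a t s < 0)))
    \<and> (a < 0 \<longrightarrow> (\<forall>J :: real set. is_interval J \<and> \<not> J \<subseteq> {1/a..0} \<longrightarrow>
          (\<exists>t\<in>J. \<exists>s. green a t s > 0) \<and> (\<exists>t\<in>J. \<exists>s. green a t s < 0)))"
proof (intro conjI impI)
  assume "a > 0"
  then show "\<forall>t\<in>{0..1/a}. AE s in lebesgue. green a t s \<ge> 0"
    by (simp add: green_nonneg)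
next
  assume "a < 0"
  \<comment> \<open>At \<open>t = s = 0\<close> the kernel is \<open>1\<close>, so the bound holds only off the null set \<open>{0}\<close>.\<close>
  have "AE s in lebesgue. s \<noteq> (0::real)"
    by (rule AE_I'[where N = "{0}"]) auto
  then show "\<forall>t\<in>{1/a..0}. AE s in lebesgue. green a t s \<le> 0"
    using \<open>a < 0\<close> by (auto intro: green_nonpos elim!: eventually_mono)
next
  assume "a > 0"
  then show "\<forall>J. is_interval J \<and> \<not> J \<subseteq> {0..1/a} \<longrightarrow>
      (\<exists>t\<in>J. \<exists>s. green a t s > 0) \<and> (\<exists>t\<in>J. \<exists>s. green a t s < 0)"
    using green_changes_sign_pos by (meson subsetI)
next
  assume "a < 0"
  then show "\<forall>J. is_interval J \<and> \<not> J \<subseteq> {1/a..0} \<longrightarrow>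
      (\<exists>t\<in>J. \<exists>s. green a t s > 0) \<and> (\<exists>t\<in>J. \<exists>s. green a t s < 0)"
    using green_changes_sign_neg by (meson subsetI)
qed

end
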